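(* Let $m\ge2$ and let $w=w_{m-1}\cdots w_0$ be a word over $\{0,1\}$ containing no factor $11$, with $w_0=1$. Let $R_w$ be the increasing sequence of all integers $N\ge0$ with $d_{m-1}(N)\cdots d_0(N)=w$. If $w$ does not have a suffix of the form $0^k1$ or $10^k1$ with $k\ge2$, then there is an integer $\gamma_w\le0$ such that $$R_w=V(L_{m-2},L_{m-3},\gamma_w)\ \text{ if } w_{m-1}=0,\qquad R_w=V(L_{m-1},L_{m-2},\gamma_w)\ \text{ if } w_{m-1}=1.$$ Moreover, for every $m\ge1$: $R_{0^{2m}1}=R_{0^{2m+1}1}=V_0(L_{2m+1},L_{2m},1)$; the word $10^{2m}1$ never occurs, i.e. there is no $N$ with $d_{2m+1}(N)\cdots d_0(N)=10^{2m}1$; and $R_{10^{2m+1}1}=V(L_{2m+2},L_{2m+1},-L_{2m+1}+1)$.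
   Context: Let $\varphi=(1+\sqrt5)/2$. Every integer $N\ge0$ has a unique base phi expansion $N=\sum_{i\in\mathbb Z} d_i(N)\varphi^i$ with $d_i(N)\in\{0,1\}$, finitely many nonzero, and $d_i(N)d_{i+1}(N)=0$ for all $i$; digits at positions beyond the leading $1$ are $0$. Lucas numbers: $L_0=2$, $L_1=1$, $L_n=L_{n-1}+L_{n-2}$. For integers $p,q,r$: $V(p,q,r)=(p\lfloor n\varphi\rfloor+qn+r)_{n\ge1}$ and $V_0(p,q,r)=(p\lfloor n\varphi\rfloor+qn+r)_{n\ge0}$. $0^k$ is the word of $k$ zeros.
   Formalization: The first claim excludes the word w = 01 (m = 2): there L_{m-3} = L_{-1} is undefined, and R_{01} = 1, 4, 8, 11, ... has differences 3 and 4, so it is not V(2, q, γ) for any integer q. *)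

theory Defs
  imports Complex_Main "HOL-Library.Sublist"
begin

definition golden :: real where
  "golden = (1 + sqrt 5) / 2"

fun lucas :: "nat \<Rightarrow> int" where
  "lucas 0 = 2"
| "lucas (Suc 0) = 1"
| "lucas (Suc (Suc n)) = lucas (Suc n) + lucas n"

definition is_base_phi :: "nat \<Rightarrow> (int \<Rightarrow> nat) \<Rightarrow> bool" where
  "is_base_phi N d \<longleftrightarrow>
     (\<forall>i. d i \<in> {0, 1}) \<and>
     finite {i. d i \<noteq> 0} \<and>
     (\<forall>i. d i * d (i + 1) = 0) \<and>
     real N = (\<Sum>i | d i \<noteq> 0. real (d i) * golden powi i)"

definition phi_digit :: "nat \<Rightarrow> int \<Rightarrow> nat" where
  "phi_digit N = (THE d. is_base_phi N d)"

text \<open>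
  Words are lists read from left to right, so the word \<open>w\<^sub>m\<^sub>-\<^sub>1 \<dots> w\<^sub>0\<close> has head \<open>w\<^sub>m\<^sub>-\<^sub>1\<close> and
  last letter \<open>w\<^sub>0\<close>.  \<open>phi_block m N\<close> is the word \<open>d\<^sub>m\<^sub>-\<^sub>1(N) \<dots> d\<^sub>0(N)\<close>.
\<close>

definition phi_block :: "nat \<Rightarrow> nat \<Rightarrow> nat list" where
  "phi_block m N = map (\<lambda>i. phi_digit N (int i)) (rev [0..<m])"

text \<open>
  \<open>is_R w s\<close> says that the sequence \<open>s\<close> (indexed from 0) is \<open>R\<^sub>w\<close>, the increasing sequence of all
  \<open>N\<close> whose digits in the last positions before the radix point form \<open>w\<close>.  It is a relation because
  there is no such infinite sequence when \<open>w\<close> does not occur.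
\<close>

definition is_R :: "nat list \<Rightarrow> (nat \<Rightarrow> int) \<Rightarrow> bool" where
  "is_R w s \<longleftrightarrow> strict_mono s \<and> range s = int ` {N. phi_block (length w) N = w}"

definition beatty0 :: "int \<Rightarrow> int \<Rightarrow> int \<Rightarrow> nat \<Rightarrow> int" where
  "beatty0 p q r n = p * \<lfloor>real n * golden\<rfloor> + q * int n + r"

text \<open>
  \<open>beatty0\<close> is \<open>V\<^sub>0\<close>; \<open>beatty1\<close> is \<open>V\<close>, whose first term (index 0 here) is the one with \<open>n = 1\<close>.
\<close>

definition beatty1 :: "int \<Rightarrow> int \<Rightarrow> int \<Rightarrow> nat \<Rightarrow> int" where
  "beatty1 p q r k = beatty0 p q r (Suc k)"

end

theory Submission
  imports Defs
begin

text \<open>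
  Write \<open>x'\<close> for the conjugate of \<open>x = a + b \<phi>\<close>.  The numbers without digits after the radix point
  are exactly the \<open>x \<ge> 0\<close> in the ring of integers with \<open>-1 < x' < \<phi>\<close>, and they are enumerated by
  \<open>a = 2 \<lfloor>k \<phi>\<rfloor> - 3 k + 1\<close>, \<open>b = 2 k - 1 - \<lfloor>k \<phi>\<rfloor>\<close> for \<open>k \<ge> 1\<close>.  If \<open>x\<close> is the integral part of the
  expansion of \<open>N\<close>, then \<open>N - x\<close> and \<open>x'\<close> differ by an integer, since \<open>x + x'\<close> is one.  If the last
  digit is 1, then \<open>N - x\<close> ranges over \<open>[0, 1/\<phi>)\<close>; hence \<open>x\<close> occurs as an integral part if and only
  if the fractional part of \<open>x'\<close> is below \<open>1/\<phi>\<close>, and then \<open>N = x + x' - \<lfloor>x'\<rfloor>\<close>.  A suffix \<open>101\<close>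
  forces \<open>1 \<le> x' < \<phi>\<close>, while after a suffix \<open>1 0\<^sup>k 1\<close> with \<open>k \<ge> 2\<close> the parity of \<open>k\<close>
  decides on which side of 1 the conjugate lies.  Writing \<open>x = v + \<phi>\<^sup>m c\<close> with the block value \<open>v\<close>, the trace
  \<open>x + x'\<close> becomes a Beatty expression in the index of \<open>c\<close>, with Lucas coefficients.
\<close>

subsection \<open>The golden ratio and its conjugate\<close>

lemma golden_square: "golden\<^sup>2 = golden + 1"
  by (simp add: golden_def power2_eq_square field_simps)

lemma golden_mult_golden [simp]: "golden * golden = golden + 1"
  using golden_square by (simp add: power2_eq_square)

lemma golden_bounds: "8 / 5 < golden" "golden < 5 / 3"
proof -
  have "11 / 5 < sqrt 5" "sqrt 5 < 7 / 3"
    by (rule real_less_rsqrt, simp add: power2_eq_square)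
       (rule real_less_lsqrt, simp_all add: power2_eq_square)
  then show "8 / 5 < golden" "golden < 5 / 3"
    by (simp_all add: golden_def)
qed

lemma golden_pos [simp]: "0 < golden" "1 < golden" "golden \<noteq> 0" "0 \<le> golden" "\<not> golden \<le> 0"
  using golden_bounds by auto

definition psi :: real where
  "psi = 1 - golden"

lemma golden_eq: "golden = 1 - psi"
  by (simp add: psi_def)

lemma psi_mult_psi [simp]: "psi * psi = psi + 1"
  by (simp add: psi_def algebra_simps)

lemma golden_psi [simp]: "golden * psi = -1"
  by (simp add: psi_def algebra_simps)

lemma psi_golden [simp]: "psi * golden = -1"
  by (metis golden_psi mult.commute)

lemma golden_mult_left [simp]: "golden * (golden * x) = golden * x + x"
  by (simp add: ring_distribs flip: mult.assoc)

lemma psi_mult_left [simp]: "psi * (psi * x) = psi * x + x"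
  by (simp add: ring_distribs flip: mult.assoc)

lemma psi_bounds: "- 2 / 3 < psi" "psi < - 3 / 5"
  using golden_bounds by (auto simp: psi_def)

text \<open>Infinite descent: modulo 2 the equation forces \<open>a\<close> and \<open>b\<close> to
  be even, and halving both gives a smaller solution.\<close>

lemma norm_form_eq_0:
  fixes a b :: int
  assumes "a * a + a * b = b * b"
  shows "a = 0"
  using assms
proof (induction "nat \<bar>a\<bar>" arbitrary: a b rule: less_induct)
  case less
  have "even a \<and> even b"
  proof (rule ccontr)
    assume "\<not> ?thesis"
    moreover have "even (a * a + a * b) \<longleftrightarrow> even (b * b)"
      using less.prems by simp
    ultimately show False
      by auto
  qed
  then obtain c d where ab: "a = 2 * c" "b = 2 * d"
    by (elim conjE evenE)
  show ?case
  proof (rule ccontr)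
    assume "a \<noteq> 0"
    then have "nat \<bar>c\<bar> < nat \<bar>a\<bar>"
      using ab by simp
    moreover have "4 * (c * c + c * d) = 4 * (d * d)"
      using less.prems unfolding ab by (simp add: ring_distribs)
    then have "c * c + c * d = d * d"
      by simp
    ultimately have "c = 0"
      by (rule less.hyps)
    then show False
      using ab \<open>a \<noteq> 0\<close> by simp
  qed
qed

text \<open>Multiplying by the conjugate gives the integer norm
  \<open>a * a + a * b - b * b\<close>, which vanishes only at zero.\<close>

lemma golden_independent:
  fixes a b :: int
  assumes "a + b * golden = 0"
  shows "a = 0" "b = 0"
proof -
  have "(a + b * golden) * (a + b * psi)
      = real_of_int a * a + real_of_int a * b * (golden + psi)
        + real_of_int b * b * (golden * psi)"
    by algebra
  also have "\<dots> = real_of_int (a * a + a * b - b * b)"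
    by (simp only: golden_psi) (simp add: psi_def)
  finally have "real_of_int (a * a + a * b - b * b) = (a + b * golden) * (a + b * psi)" ..
  then have "a * a + a * b - b * b = 0"
    using assms by (metis mult_zero_left of_int_eq_0_iff)
  then show "a = 0"
    using norm_form_eq_0[of a b] by simp
  then show "b = 0"
    using assms by simp
qed

lemma lucas_binet: "of_int (lucas n) = golden ^ n + psi ^ n"
proof (induction n rule: lucas.induct)
  case (3 n)
  have "golden ^ Suc (Suc n) = (golden + 1) * golden ^ n" "psi ^ Suc (Suc n) = (psi + 1) * psi ^ n"
    by (simp_all only: power_Suc golden_mult_golden psi_mult_psi flip: mult.assoc)
  with 3 show ?case by (simp add: algebra_simps)
qed (simp_all add: psi_def)

lemma lucas_pos: "1 \<le> lucas n"
  by (induction n rule: lucas.induct) auto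

subsection \<open>Digit strings\<close>

abbreviation val :: "real \<Rightarrow> nat list \<Rightarrow> real" where
  "val \<equiv> horner_sum of_nat"

text \<open>Here the least significant digit comes first, so digit words enter reversed.\<close>

inductive admissible :: "nat list \<Rightarrow> bool" where
  Nil: "admissible []"
| Zero: "admissible xs \<Longrightarrow> admissible (0 # xs)"
| One: "admissible [1]"
| OneZero: "admissible xs \<Longrightarrow> admissible (1 # 0 # xs)"

text \<open>The inductive form lets an induction remove a 1 together with the 0 that must follow it;
  the form on the right handles concatenation and reversal.\<close>

lemma admissible_iff:
  "admissible xs \<longleftrightarrow> set xs \<subseteq> {0, 1} \<and> successively (\<lambda>a b. a * b = 0) xs"
proof
  show "admissible xs \<Longrightarrow> set xs \<subseteq> {0, 1} \<and> successively (\<lambda>a b. a * b = 0) xs"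
    by (induction rule: admissible.induct) (auto simp: successively_Cons)
  show "set xs \<subseteq> {0, 1} \<and> successively (\<lambda>a b. a * b = 0) xs \<Longrightarrow> admissible xs"
  proof (induction "length xs" arbitrary: xs rule: less_induct)
    case less
    show ?case
    proof (cases xs)
      case Nil
      then show ?thesis by (simp add: admissible.Nil)
    next
      case (Cons a ys)
      show ?thesis
      proof (cases "a = 0")
        case True
        then show ?thesis
          using less Cons by (auto simp: successively_Cons intro!: admissible.Zero)
      next
        case False
        then have a: "a = 1" using less.prems Cons by auto
        show ?thesis
        proof (cases ys)
          case Nil
          then show ?thesis using a Cons admissible.One by simp
        next
          case (Cons b zs)
          then show ?thesis
            using less a \<open>xs = a # ys\<close>
            by (auto simp: successively_Cons intro!: admissible.OneZero[simplified])
        qed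
      qed
    qed
  qed
qed

lemma admissible_rev [simp]: "admissible (rev xs) \<longleftrightarrow> admissible xs"
proof -
  have "(\<lambda>a b :: nat. b * a = 0) = (\<lambda>a b. a * b = 0)" by auto
  then show ?thesis by (simp only: admissible_iff successively_rev set_rev)
qed

lemma admissible_append_iff:
  "admissible (xs @ ys) \<longleftrightarrow>
     admissible xs \<and> admissible ys \<and> (xs = [] \<or> ys = [] \<or> last xs * hd ys = 0)"
  by (auto simp: admissible_iff successively_append_iff)

lemma admissible_Cons_0 [simp]: "admissible (0 # xs) \<longleftrightarrow> admissible xs"
  by (auto simp: admissible_iff successively_Cons)

lemma admissible_Cons_1_0 [simp]: "admissible (Suc 0 # 0 # xs) \<longleftrightarrow> admissible xs"
  by (auto simp: admissible_iff successively_Cons)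

lemma admissible_replicate_0_append [simp]: "admissible (replicate n 0 @ xs) \<longleftrightarrow> admissible xs"
  by (induction n) auto

lemma val_replicate_0 [simp]: "val x (replicate n 0) = 0"
  by (induction n) auto

lemma val_golden_nonneg: "0 \<le> val golden xs"
  by (induction xs) auto

text \<open>Both digit steps map the window (-1, \<phi>) into itself: \<psi> y lies in (-1, \<phi> -
  1) and 1 + \<psi>^2 y in (\<phi> - 1, \<phi>).\<close>

lemma val_psi_bounds:
  assumes "admissible xs"
  shows "-1 < val psi xs" "val psi xs < golden"
proof -
  have "-1 < val psi xs \<and> val psi xs < golden"
    using assms
  proof (induction rule: admissible.induct)
    case (Zero xs)
    then have "psi * golden < psi * val psi xs" "psi * val psi xs < psi * (-1)"
      using psi_bounds by (intro mult_strict_left_mono_neg; simp)+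
    then show ?case
      using golden_bounds psi_bounds by simp
  next
    case (OneZero xs)
    have "psi * psi * (-1) < psi * psi * val psi xs" "psi * psi * val psi xs < psi * psi * golden"
      using psi_bounds OneZero by (intro mult_strict_left_mono; simp)+
    then have "- (psi + 1) < (psi + 1) * val psi xs" "(psi + 1) * val psi xs < golden - 1"
      by (simp_all add: algebra_simps)
    then have "-1 < 1 + psi * (psi * val psi xs)" "1 + psi * (psi * val psi xs) < golden"
      using psi_bounds by (simp_all flip: mult.assoc)
    then show ?case by simp
  qed (use golden_bounds in auto)
  then show "-1 < val psi xs" "val psi xs < golden" by auto
qed

text \<open>The two images in the window are separated by \<phi> - 1, so the conjugate alone reveals
  the lowest digit.\<close>

lemma val_psi_Cons_0:
  assumes "admissible xs"
  shows "val psi (0 # xs) < golden - 1"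
proof -
  have "psi * val psi xs < psi * (-1)"
    using psi_bounds val_psi_bounds[OF assms] by (intro mult_strict_left_mono_neg) auto
  then show ?thesis by (simp add: psi_def)
qed

lemma val_psi_Cons_1:
  assumes "admissible (Suc 0 # xs)"
  shows "golden - 1 < val psi (Suc 0 # xs)"
  using assms
proof cases
  case One
  then show ?thesis using golden_bounds by simp
next
  case (OneZero ys)
  have "psi * psi * (-1) < psi * psi * val psi ys"
    using psi_bounds val_psi_bounds[of ys] OneZero
    by (intro mult_strict_left_mono) simp_all
  then have "- psi < 1 + psi * (psi * val psi ys)"
    by (simp flip: mult.assoc)
  then show ?thesis
    using OneZero psi_def by simp
qed

text \<open>Comparison with \<phi> - 1 fixes the lowest digit; removing it and dividing by \<psi>
  leads to the rest.\<close>

lemma val_psi_inj: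
  assumes "admissible xs" "admissible ys" "length xs = length ys" "val psi xs = val psi ys"
  shows "xs = ys"
  using assms
proof (induction xs arbitrary: ys rule: list.induct)
  case (Cons a xs)
  then obtain b zs where ys: "ys = b # zs" by (cases ys) auto
  have tl: "admissible xs" "admissible zs"
    using Cons.prems ys by (auto simp: admissible_iff successively_Cons)
  have "a = b"
  proof (rule ccontr)
    assume "a \<noteq> b"
    moreover have "a \<in> {0, 1}" "b \<in> {0, 1}"
      using Cons.prems ys by (auto simp: admissible_iff)
    ultimately show False
      using Cons.prems ys tl val_psi_Cons_0[of xs] val_psi_Cons_0[of zs]
        val_psi_Cons_1[of xs] val_psi_Cons_1[of zs] by auto
  qed
  have "psi * val psi xs = psi * val psi zs"
    using Cons.prems(4) by (simp add: ys \<open>a = b\<close>)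
  then have "val psi xs = val psi zs"
    using psi_bounds by simp
  then have "xs = zs"
    using Cons.IH[of zs] Cons.prems(3) tl ys by simp
  then show ?case
    using ys \<open>a = b\<close> by simp
qed simp

lemma val_golden_less:
  assumes "admissible xs"
  shows "val golden xs < golden ^ length xs"
proof -
  \<comment> \<open>Reversal makes the induction strip the most significant digits: a leading 10
    contributes \<phi>^(n+1), the rest less than \<phi>^n, together less than \<phi>^(n+2).\<close>
  have "val golden (rev ys) < golden ^ length ys" if "admissible ys" for ys
    using that
  proof (induction rule: admissible.induct)
    case (Zero xs)
    have "golden ^ length xs \<le> golden ^ length (0 # xs)"
      using golden_bounds by (intro power_increasing) auto
    with Zero.IH have "val golden (rev xs) < golden ^ length (0 # xs)"
      by linarith
    then show ?case
      by (simp add: horner_sum_append)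
  next
    case (OneZero xs)
    have "golden ^ Suc (Suc (length xs)) = golden ^ length xs * (golden * golden)"
      by (simp only: power_Suc mult_ac)
    with OneZero show ?case by (simp add: horner_sum_append algebra_simps)
  qed auto
  from this[of "rev xs"] assms show ?thesis by simp
qed

text \<open>The digit just below a 1 is 0, which gains a factor \<phi>. For the digits after the
  radix point this yields the bound 1/\<phi>.\<close>

lemma val_golden_less_before_1:
  assumes "admissible (xs @ 1 # ys)"
  shows "golden * val golden xs < golden ^ length xs"
proof (cases xs rule: rev_cases)
  case (snoc zs a)
  then have "admissible zs" "a = 0"
    using assms by (simp_all add: admissible_iff successively_append_iff)
  then show ?thesis
    using val_golden_less[of zs] snoc by (simp add: horner_sum_append)
qed simp

lemma val_in_golden_ring:
  "\<exists>(a :: int) (b :: int). val golden xs = a + b * golden \<and> val psi xs = a + b * psi"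
proof (induction xs)
  case Nil
  show ?case by (rule exI[of _ 0], rule exI[of _ 0]) simp
next
  case (Cons d xs)
  then obtain a b :: int where "val golden xs = a + b * golden" "val psi xs = a + b * psi"
    by blast
  then show ?case
    by (intro exI[of _ "int d + b"] exI[of _ "a + b"]) (simp add: algebra_simps)
qed

text \<open>By linear independence the value at \<phi> fixes both coefficients, so conjugation is
  well defined.\<close>

lemma val_golden_eq_imp_val_psi_eq:
  fixes a b :: int
  assumes "val golden xs = a + b * golden"
  shows "val psi xs = a + b * psi"
proof -
  obtain c d :: int where cd: "val golden xs = c + d * golden" "val psi xs = c + d * psi"
    using val_in_golden_ring by blast
  have "real_of_int (c - a) + of_int (d - b) * golden = 0"
    using cd assms by (simp add: algebra_simps)
  from golden_independent[OF this] show ?thesis using cd by simp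
qed


section \<open>Existence of digit strings\<close>

lemma golden_coeff_eq_0:
  fixes a b :: int
  assumes "(a + b * golden) - (a + b * psi) < 2 * golden - 1"
    and "1 - 2 * golden < (a + b * golden) - (a + b * psi)"
  shows "b = 0"
proof -
  \<comment> \<open>The factor \<open>2 * golden - 1\<close> is the square root of 5.\<close>
  have "(a + b * golden) - (a + b * psi) = b * (2 * golden - 1)"
    by (simp add: psi_def algebra_simps)
  with assms have "\<bar>real_of_int b * (2 * golden - 1)\<bar> < 1 * (2 * golden - 1)"
    by (simp add: abs_less_iff)
  then have "\<bar>real_of_int b\<bar> < 1"
    using golden_bounds by (simp add: abs_mult)
  then show ?thesis by linarith
qed

text \<open>Digits are peeled off at the low end. If x' is below \<phi> - 1, the digit is 0 and x is
  divided by \<phi>; if it is above, the digits are 1, 0 and x becomes (x - 1)/\<phi>^2. Both steps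
  keep the conjugate in the window.\<close>

lemma exists_digits:
  fixes a b :: int
  assumes "0 \<le> a + b * golden" "a + b * golden < golden ^ n"
    and "-1 < a + b * psi" "a + b * psi < golden"
  shows "\<exists>xs. length xs = n \<and> admissible xs \<and> val golden xs = a + b * golden"
  using assms
proof (induction n arbitrary: a b rule: less_induct)
  case (less n)
  show ?case
  proof (cases "a + b * psi < golden - 1")
    case True
    show ?thesis
    proof (cases n)
      case 0
      have "b = 0"
        using less.prems golden_bounds 0 by (intro golden_coeff_eq_0[of a b]; simp)
      then have "a = 0" using less.prems 0 by auto
      with \<open>b = 0\<close> 0 show ?thesis by (auto intro: admissible.intros)
    next
      case (Suc k)
      \<comment> \<open>\<open>c + a * golden\<close> is x/\<phi>.\<close>
      define c where "c = b - a"
      have eq: "a + b * golden = golden * (c + a * golden)"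
        and eq': "a + b * psi = psi * (c + a * psi)"
        by (simp_all add: c_def algebra_simps)
      have "0 \<le> c + a * golden"
        using less.prems(1) unfolding eq by (simp add: zero_le_mult_iff)
      moreover have "c + a * golden < golden ^ k"
        using less.prems(2) unfolding eq Suc by simp
      moreover have "psi * (c + a * psi) < psi * (-1)"
        using True unfolding eq' by (simp add: psi_def)
      then have "-1 < c + a * psi"
        using psi_bounds by (subst (asm) mult_less_cancel_left) auto
      moreover have "psi * golden < psi * (c + a * psi)"
        using less.prems(3) unfolding eq' by (simp add: mult.commute)
      then have "c + a * psi < golden"
        using psi_bounds by (subst (asm) mult_less_cancel_left) auto
      ultimately obtain xs where "length xs = k" "admissible xs" "val golden xs = c + a * golden"
        using less.IH[of k c a] Suc by auto
      then show ?thesis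
        by (intro exI[of _ "0 # xs"]) (simp add: Suc eq)
    qed
  next
    case False
    \<comment> \<open>Equality would mean x' = -\<psi>, so x = -\<phi>, which is negative.\<close>
    have "a + b * psi \<noteq> golden - 1"
    proof
      assume "a + b * psi = golden - 1"
      then have "real_of_int (a + b + 1) + of_int (- b - 1) * golden = 0"
        by (simp add: psi_def algebra_simps)
      from golden_independent[OF this] have "b = -1" "a = 0" by auto
      then show False using less.prems by simp
    qed
    with False have gt: "golden - 1 < a + b * psi" by simp
    \<comment> \<open>A 1 can be subtracted: for x < 1 the distance from x to x' is below sqrt 5, so
      x = x' would be an integer strictly between \<phi> - 1 and 1.\<close>
    have ge1: "1 \<le> a + b * golden"
    proof (rule ccontr)
      assume "\<not> ?thesis"
      then have lt: "a + b * golden < 1" by simp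
      have "b = 0"
        using less.prems(1,3,4) gt lt golden_bounds by (intro golden_coeff_eq_0[of a b]; linarith)
      then show False using less.prems lt gt golden_bounds by auto
    qed
    consider "n = 0" | "n = 1" | k where "n = Suc (Suc k)"
      by (metis One_nat_def not0_implies_Suc)
    then show ?thesis
    proof cases
      case 1
      then show ?thesis using less.prems ge1 by simp
    next
      case 2
      then have "a + b * golden < golden" using less.prems(2) by simp
      then have "b = 0"
        using less.prems(3,4) gt golden_bounds ge1 by (intro golden_coeff_eq_0[of a b]; linarith)
      moreover from this have "a < 2" "1 \<le> a"
        using less.prems 2 ge1 golden_bounds by auto
      then have "a = 1" by simp
      ultimately show ?thesis
        using 2 admissible.One by (intro exI[of _ "[1]"]) auto
    next
      case 3
      \<comment> \<open>These are the coefficients of (x - 1)/\<phi>^2, from 1/\<phi>^2 = 2 -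
        \<phi>.\<close>
      define c d where "c = 2 * (a - 1) - b" and "d = b - (a - 1)"
      have eq: "a + b * golden = 1 + golden * golden * (c + d * golden)"
        and eq': "a + b * psi = 1 + psi * psi * (c + d * psi)"
        by (simp_all add: c_def d_def algebra_simps)
      have "0 \<le> c + d * golden"
        using ge1 golden_bounds unfolding eq by (auto simp: zero_le_mult_iff)
      moreover have "golden * golden * (c + d * golden) < golden * golden * golden ^ k"
        using less.prems(2) unfolding eq 3 power_Suc mult.assoc by linarith
      then have "c + d * golden < golden ^ k"
        by (simp add: mult_less_cancel_left)
      moreover have "psi * psi * (-1) < psi * psi * (c + d * psi)"
        using gt golden_eq unfolding eq' by (simp add: algebra_simps)
      then have "-1 < c + d * psi"
        using psi_bounds unfolding mult_less_cancel_left by auto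
      moreover have "psi * psi * (c + d * psi) < psi * psi * golden"
        using less.prems(4) unfolding eq' by (simp add: psi_def algebra_simps)
      then have "c + d * psi < golden"
        using psi_bounds unfolding mult_less_cancel_left by auto
      ultimately obtain xs where "length xs = k" "admissible xs" "val golden xs = c + d * golden"
        using less.IH[of k c d] 3 by auto
      then show ?thesis
        using eq by (intro exI[of _ "1 # 0 # xs"]) (simp add: 3 distrib_right[of golden 1])
    qed
  qed
qed

subsection \<open>Base phi expansions\<close>

definition slice :: "(int \<Rightarrow> nat) \<Rightarrow> int \<Rightarrow> nat \<Rightarrow> nat list" where
  "slice d j n = map (\<lambda>i. d (j + int i)) [0..<n]"

lemma length_slice [simp]: "length (slice d j n) = n"
  by (simp add: slice_def)

lemma nth_slice [simp]: "i < n \<Longrightarrow> slice d j n ! i = d (j + int i)"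
  by (simp add: slice_def)

lemma slice_add: "slice d j (m + n) = slice d j m @ slice d (j + int m) n"
  by (rule nth_equalityI) (auto simp: nth_append add.assoc)

lemma rev_phi_block: "rev (phi_block m N) = slice (phi_digit N) 0 m"
  by (simp add: phi_block_def slice_def rev_map)

text \<open>Multiplying by \<phi>^K moves the support to positions from 0 on, which turns an
  expansion into a finite word.\<close>

lemma is_base_phi_iff_slice:
  assumes supp: "\<And>i. d i \<noteq> 0 \<Longrightarrow> - int K \<le> i \<and> i < int n - int K"
  shows "is_base_phi N d \<longleftrightarrow>
    admissible (slice d (- int K) n) \<and> val golden (slice d (- int K) n) = golden ^ K * N"
proof -
  have fin: "finite {i. d i \<noteq> 0}"
    by (rule finite_subset[of _ "{- int K..<int n - int K}"]) (use supp in auto)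
  have "(\<Sum>i | d i \<noteq> 0. real (d i) * golden powi i)
      = (\<Sum>i\<in>{- int K..<int n - int K}. real (d i) * golden powi i)"
    by (rule sum.mono_neutral_left) (use supp in auto)
  also have "\<dots> = (\<Sum>j\<in>{0..<n}. real (d (- int K + int j)) * golden powi (- int K + int j))"
    by (rule sum.reindex_bij_witness[of _ "\<lambda>j. - int K + int j" "\<lambda>i. nat (i + int K)"]) auto
  also have "golden ^ K * \<dots> = (\<Sum>j\<in>{0..<n}. real (d (- int K + int j)) * golden ^ j)"
    by (simp add: sum_distrib_left power_int_diff)
  also have "\<dots> = val golden (slice d (- int K) n)"
    by (simp add: horner_sum_eq_sum)
  finally have "golden ^ K * (\<Sum>i | d i \<noteq> 0. real (d i) * golden powi i)
    = val golden (slice d (- int K) n)" .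
  then have sum: "real N = (\<Sum>i | d i \<noteq> 0. real (d i) * golden powi i) \<longleftrightarrow>
      val golden (slice d (- int K) n) = golden ^ K * N"
    by (metis golden_pos(3) mult_left_cancel power_not_zero)
  have range: "set (slice d (- int K) n) \<subseteq> range d"
    by (auto simp: slice_def)
  have "(\<forall>i. d i \<in> {0, 1}) \<longleftrightarrow> set (slice d (- int K) n) \<subseteq> {0, 1}"
  proof
    assume *: "set (slice d (- int K) n) \<subseteq> {0, 1}"
    show "\<forall>i. d i \<in> {0, 1}"
    proof
      fix i
      have "d i \<in> set (slice d (- int K) n)" if "d i \<noteq> 0"
        using supp[OF that] nth_mem[of "nat (i + int K)" "slice d (- int K) n"]
        by (simp add: nat_less_iff)
      then show "d i \<in> {0, 1}" using * by auto
    qed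
  qed (rule order_trans[OF range], simp add: image_subset_iff)
  moreover have "(\<forall>i. d i * d (i + 1) = 0) \<longleftrightarrow>
      successively (\<lambda>a b. a * b = 0) (slice d (- int K) n)"
  proof
    assume *: "successively (\<lambda>a b. a * b = 0) (slice d (- int K) n)"
    show "\<forall>i. d i * d (i + 1) = 0"
    proof (rule allI, rule ccontr)
      fix i
      assume "d i * d (i + 1) \<noteq> 0"
      then have "- int K \<le> i" "Suc (nat (i + int K)) < n"
        using supp[of i] supp[of "i + 1"] by auto
      with \<open>d i * d (i + 1) \<noteq> 0\<close> show False
        using successively_nth[OF *, of "nat (i + int K)"] by (simp add: algebra_simps)
    qed
  qed (auto simp: successively_conv_nth algebra_simps)
  ultimately show ?thesis
    using fin sum by (auto simp: is_base_phi_def admissible_iff)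
qed

section \<open>Uniqueness and existence of the expansion\<close>

lemma finite_support_bound:
  fixes d :: "int \<Rightarrow> nat"
  assumes "finite {i. d i \<noteq> 0}"
  obtains K where "\<And>i. d i \<noteq> 0 \<Longrightarrow> \<bar>i\<bar> < int K"
proof
  fix i assume "d i \<noteq> 0"
  then have "nat \<bar>i\<bar> \<le> (\<Sum>i | d i \<noteq> 0. nat \<bar>i\<bar>)"
    using assms by (intro member_le_sum) auto
  then show "\<bar>i\<bar> < int (Suc (\<Sum>i | d i \<noteq> 0. nat \<bar>i\<bar>))" by linarith
qed

lemma val_golden_inj:
  assumes "admissible xs" "admissible ys" "length xs = length ys"
    and "val golden xs = val golden ys"
  shows "xs = ys"
proof (rule val_psi_inj)
  obtain a b :: int where "val golden xs = a + b * golden" "val psi xs = a + b * psi"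
    using val_in_golden_ring by blast
  then show "val psi xs = val psi ys"
    using val_golden_eq_imp_val_psi_eq[of ys a b] assms by simp
qed (use assms in auto)

lemma is_base_phi_unique:
  assumes "is_base_phi N d" "is_base_phi N e"
  shows "d = e"
proof
  fix i
  obtain K L where K: "\<And>i. d i \<noteq> 0 \<Longrightarrow> \<bar>i\<bar> < int K" and L: "\<And>i. e i \<noteq> 0 \<Longrightarrow> \<bar>i\<bar> < int L"
    using finite_support_bound assms unfolding is_base_phi_def by metis
  define M where "M = K + L"
  have supp: "- int M \<le> i \<and> i < int (2 * M) - int M" if "d i \<noteq> 0 \<or> e i \<noteq> 0" for i
    using that K[of i] L[of i] by (auto simp: M_def)
  have "slice d (- int M) (2 * M) = slice e (- int M) (2 * M)"
    using assms is_base_phi_iff_slice[of d M "2 * M" N] is_base_phi_iff_slice[of e M "2 * M" N] supp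
    by (intro val_golden_inj) auto
  then have "slice d (- int M) (2 * M) ! nat (i + int M) = slice e (- int M) (2 * M) ! nat (i + int M)"
    by simp
  then show "d i = e i"
    using supp[of i] by (cases "d i \<noteq> 0 \<or> e i \<noteq> 0") auto
qed

lemma phi_digit_eqI: "is_base_phi N d \<Longrightarrow> phi_digit N = d"
  unfolding phi_digit_def by (rule the_equality) (auto intro: is_base_phi_unique)

lemma slice_phi_digit:
  assumes "admissible xs" "val golden xs = golden ^ K * N"
  shows "is_base_phi N (phi_digit N)" "slice (phi_digit N) (- int K) (length xs) = xs"
proof -
  define d where "d i = (if - int K \<le> i \<and> i < int (length xs) - int K then xs ! nat (i + int K) else 0)" for i
  have xs: "slice d (- int K) (length xs) = xs"
    by (rule nth_equalityI) (auto simp: d_def)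
  have "is_base_phi N d"
    by (subst is_base_phi_iff_slice[of d K "length xs"])
       (use assms xs in \<open>auto simp: d_def split: if_splits\<close>)
  with xs show "is_base_phi N (phi_digit N)" "slice (phi_digit N) (- int K) (length xs) = xs"
    by (simp_all add: phi_digit_eqI)
qed

lemma golden_power_in_ring:
  fixes p q :: int
  shows "\<exists>(a :: int) (b :: int). golden ^ k * (p + q * golden) = a + b * golden \<and>
    psi ^ k * (p + q * psi) = a + b * psi"
proof (induction k)
  case (Suc k)
  then obtain a b :: int where
    "golden ^ k * (p + q * golden) = a + b * golden" "psi ^ k * (p + q * psi) = a + b * psi"
    by blast
  then have "golden ^ Suc k * (p + q * golden) = b + (a + b) * golden"
    "psi ^ Suc k * (p + q * psi) = b + (a + b) * psi"
    by (simp_all only: power_Suc mult.assoc) (simp_all add: algebra_simps)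
  then show ?case
    by (intro exI[of _ b] exI[of _ "a + b"]) simp
qed auto

text \<open>Multiplication by a large power of the golden ratio shrinks the conjugate into the window
  of the numbers that have no digits after the radix point.\<close>

lemma golden_ring_shift:
  fixes p q :: int
  obtains K :: nat and a b :: int where "0 < K" "golden ^ K * (p + q * golden) = a + b * golden"
    "-1 < a + b * psi" "a + b * psi < golden"
proof -
  \<comment> \<open>The bound |\<psi>|^k < y brings the conjugate multiplied by \<psi>^(k+1) into
    (-1, 1). The exponent \<open>Suc k\<close> makes \<open>K\<close> positive, which later leaves
    room for a digit 0 at position -1.\<close>
  define y where "y = 1 / (1 + \<bar>p + q * psi\<bar>)"
  have "0 < y" by (simp add: y_def)
  then obtain k where k: "\<bar>psi\<bar> ^ k < y"
    using real_arch_pow_inv[of y "\<bar>psi\<bar>"] psi_bounds by auto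
  have "\<bar>psi\<bar> ^ Suc k \<le> \<bar>psi\<bar> ^ k"
    using psi_bounds by (intro power_decreasing) auto
  with k have "\<bar>psi ^ Suc k\<bar> < y"
    by (simp add: power_abs abs_mult)
  then have "\<bar>psi ^ Suc k\<bar> * (1 + \<bar>p + q * psi\<bar>) < 1"
    by (simp add: y_def pos_less_divide_eq)
  moreover have "\<bar>psi ^ Suc k * (p + q * psi)\<bar> \<le> \<bar>psi ^ Suc k\<bar> * (1 + \<bar>p + q * psi\<bar>)"
    by (simp only: abs_mult) (intro mult_left_mono; simp)
  ultimately have small: "\<bar>psi ^ Suc k * (p + q * psi)\<bar> < 1"
    by linarith
  obtain a b :: int where "golden ^ Suc k * (p + q * golden) = a + b * golden"
      "psi ^ Suc k * (p + q * psi) = a + b * psi"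
    using golden_power_in_ring[of "Suc k" p q] by blast
  with small golden_bounds show thesis
    by (intro that[of "Suc k" a b]) auto
qed

text \<open>Existence: for a suitable K the element \<phi>^K N has no digits after the radix point,
  and moving its digits down by K places expands N.\<close>

lemma is_base_phi_phi_digit: "is_base_phi N (phi_digit N)"
proof -
  obtain K and a b :: int where K: "golden ^ K * (int N + (0::int) * golden) = a + b * golden"
    "-1 < a + b * psi" "a + b * psi < golden"
    using golden_ring_shift[of "int N" 0] by metis
  obtain n where n: "a + b * golden < golden ^ n"
    using real_arch_pow[of golden] by auto
  have "0 \<le> a + b * golden" by (simp flip: K(1))
  from exists_digits[OF this n K(2,3)] obtain xs
    where "admissible xs" "val golden xs = golden ^ K * N"
    using K(1) by auto
  then show ?thesis by (rule slice_phi_digit)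
qed

text \<open>The digit string \<open>cs\<close> is the part of the expansion to the left of the block \<open>w\<close>, and the
  difference to \<open>N\<close> is the part after the radix point.\<close>

lemma phi_block_eq_iff:
  assumes w: "w \<noteq> []" "last w = 1"
  shows "phi_block (length w) N = w \<longleftrightarrow>
    (\<exists>cs. admissible (rev w @ cs) \<and> val golden (rev w @ cs) \<le> N \<and>
      N < val golden (rev w @ cs) + golden - 1)"
proof
  obtain v where v: "rev w = 1 # v"
    using w by (metis hd_rev list.exhaust_sel rev_is_Nil_conv)
  {
    assume "phi_block (length w) N = w"
    then have w': "slice (phi_digit N) 0 (length w) = rev w"
      by (metis rev_phi_block)
    obtain K where K: "\<And>i. phi_digit N i \<noteq> 0 \<Longrightarrow> \<bar>i\<bar> < int K"
      using finite_support_bound is_base_phi_phi_digit unfolding is_base_phi_def by metis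
    define fs cs where "fs = slice (phi_digit N) (- int K) K"
      and "cs = slice (phi_digit N) (int (length w)) K"
    have "slice (phi_digit N) (- int K) (K + (length w + K)) = fs @ rev w @ cs"
      unfolding slice_add by (simp add: fs_def cs_def w')
    moreover have "- int K \<le> i \<and> i < int (K + (length w + K)) - int K" if "phi_digit N i \<noteq> 0" for i
      using K[OF that] by auto
    ultimately have *: "admissible (fs @ rev w @ cs)" "val golden (fs @ rev w @ cs) = golden ^ K * N"
      using is_base_phi_iff_slice[of "phi_digit N" K "K + (length w + K)" N]
        is_base_phi_phi_digit[of N] by auto
    have len: "length fs = K" by (simp add: fs_def)
    \<comment> \<open>The 1 at position 0 forces a 0 at position -1, so the fractional part stays
      below 1/\<phi> = \<phi> - 1.\<close>
    have "golden * val golden fs < golden ^ K"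
      using val_golden_less_before_1[of fs "v @ cs"] * by (simp add: v len)
    then have "golden * val golden fs * (golden - 1) < golden ^ K * (golden - 1)"
      using golden_bounds by simp
    then have "val golden fs < golden ^ K * (golden - 1)"
      by (simp add: algebra_simps)
    moreover have "val golden fs = golden ^ K * (N - val golden (rev w @ cs))"
      using *(2) len by (simp add: horner_sum_append[of _ _ fs] algebra_simps)
    ultimately have "0 \<le> N - val golden (rev w @ cs)" "N - val golden (rev w @ cs) < golden - 1"
      using val_golden_nonneg[of fs] zero_less_power[OF golden_pos(1), of K]
      by (simp_all add: zero_le_mult_iff del: zero_less_power)
    moreover have "admissible (rev w @ cs)"
      using *(1) unfolding admissible_append_iff[of fs] by simp
    ultimately show "\<exists>cs. admissible (rev w @ cs) \<and> val golden (rev w @ cs) \<le> N \<and>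
      N < val golden (rev w @ cs) + golden - 1"
      by (intro exI[of _ cs]) auto
  }
  {
    assume "\<exists>cs. admissible (rev w @ cs) \<and> val golden (rev w @ cs) \<le> N \<and>
      N < val golden (rev w @ cs) + golden - 1"
    then obtain cs where cs: "admissible (rev w @ cs)" "val golden (rev w @ cs) \<le> N"
      "N < val golden (rev w @ cs) + golden - 1" by blast
    obtain p q :: int where pq: "val golden (rev w @ cs) = p + q * golden"
      using val_in_golden_ring by blast
    obtain K and a b :: int where K: "0 < K"
      "golden ^ K * ((int N - p) + (- q) * golden) = a + b * golden"
      "-1 < a + b * psi" "a + b * psi < golden"
      using golden_ring_shift[of "int N - p" "- q"] by metis
    have x: "golden ^ K * (N - val golden (rev w @ cs)) = a + b * golden"
      using K(2) pq by (simp add: algebra_simps)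
    then have nonneg: "0 \<le> a + b * golden"
      using cs by (simp flip: x)
    have "golden ^ K * (N - val golden (rev w @ cs)) < golden ^ K * (golden - 1)"
      using cs by simp
    also have "\<dots> = golden ^ (K - 1)"
      using K(1) by (cases K) (simp_all add: algebra_simps)
    finally have "a + b * golden < golden ^ (K - 1)"
      by (simp add: x)
    from exists_digits[OF nonneg this K(3,4)] obtain fs
      where fs: "length fs = K - 1" "admissible fs" "val golden fs = a + b * golden"
      by blast
    \<comment> \<open>Since the fractional part is below 1/\<phi>, its digits fill only
      \<open>K - 1\<close> places; the added 0 sits at position -1 and separates them from the 1 at
      position 0.\<close>
    define xs where "xs = (fs @ [0]) @ rev w @ cs"
    have len: "length (fs @ [0]) = K" using fs K by simp
    have "admissible xs"
      unfolding xs_def admissible_append_iff[of "fs @ [0]"]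
      using fs cs(1) by (simp add: admissible_append_iff[of fs] admissible.Nil)
    moreover have "val golden xs = golden ^ K * N"
      unfolding xs_def horner_sum_append[of _ _ "fs @ [0]"] len
      using fs x by (simp add: horner_sum_append[of _ _ fs] algebra_simps)
    ultimately have "slice (phi_digit N) (- int K) (length xs) = xs"
      by (rule slice_phi_digit)
    moreover have "length xs = K + (length w + length cs)"
      using len by (simp add: xs_def)
    ultimately have "slice (phi_digit N) (- int K) (K + (length w + length cs)) = xs"
      by (simp only:)
    then have "slice (phi_digit N) (- int K) K @ slice (phi_digit N) 0 (length w)
        @ slice (phi_digit N) (int (length w)) (length cs) = (fs @ [0]) @ rev w @ cs"
      unfolding slice_add by (simp add: xs_def)
    then have "slice (phi_digit N) 0 (length w) = rev w"
      using len by (metis append_eq_append_conv length_rev length_slice)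
    then show "phi_block (length w) N = w"
      by (metis rev_phi_block rev_rev_ident)
  }
qed

subsection \<open>Beatty sequences\<close>

lemma admissible_val_iff:
  fixes a b :: int
  shows "(\<exists>cs. admissible cs \<and> val golden cs = a + b * golden) \<longleftrightarrow>
    0 \<le> a + b * golden \<and> -1 < a + b * psi \<and> a + b * psi < golden"
proof
  assume "\<exists>cs. admissible cs \<and> val golden cs = a + b * golden"
  then obtain cs where cs: "admissible cs" "val golden cs = a + b * golden" by blast
  then show "0 \<le> a + b * golden \<and> -1 < a + b * psi \<and> a + b * psi < golden"
    using val_golden_nonneg[of cs] val_psi_bounds[of cs] val_golden_eq_imp_val_psi_eq[of cs a b]
    by simp
next
  assume *: "0 \<le> a + b * golden \<and> -1 < a + b * psi \<and> a + b * psi < golden"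
  obtain n where "a + b * golden < golden ^ n"
    using real_arch_pow[of golden] by auto
  with * show "\<exists>cs. admissible cs \<and> val golden cs = a + b * golden"
    using exists_digits[of a b n] by blast
qed

lemma frac_golden_pos:
  assumes "0 < k"
  shows "of_int \<lfloor>real k * golden\<rfloor> < real k * golden"
proof (rule ccontr)
  assume "\<not> ?thesis"
  then have "of_int (- \<lfloor>real k * golden\<rfloor>) + of_int (int k) * golden = 0"
    unfolding of_int_minus of_int_of_nat_eq
    using of_int_floor_le[of "real k * golden"] by linarith
  from golden_independent(2)[OF this] assms show False by simp
qed

text \<open>With n = a + 2b + 1 and F = 2a + 3b + 1 the conjugate is \<phi> - \<phi>^2 (n \<phi> -
  F). The window has length \<phi>^2, so lying in it means that n \<phi> - F is in (0, 1) and F is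
  the floor. Within the window, x \<ge> 0 amounts to n \<ge> 1.\<close>

lemma window_iff_floor:
  fixes a b :: int
  shows "0 \<le> a + b * golden \<and> -1 < a + b * psi \<and> a + b * psi < golden \<longleftrightarrow>
    (\<exists>k. a = 2 * \<lfloor>real (Suc k) * golden\<rfloor> - 3 * int (Suc k) + 1 \<and>
      b = 2 * int (Suc k) - 1 - \<lfloor>real (Suc k) * golden\<rfloor>)"
proof
  assume "0 \<le> a + b * golden \<and> -1 < a + b * psi \<and> a + b * psi < golden"
  then have *: "0 \<le> a + b * golden" "-1 < a + b * psi" "a + b * psi < golden"
    by blast+
  define F where "F = 2 * a + 3 * b + 1"
  have t: "a + b * psi = golden - (golden + 1) * ((a + 2 * b + 1) * golden - F)"
    by (simp add: F_def psi_def algebra_simps)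
  have "-1 < golden - y \<Longrightarrow> y < (golden + 1) * 1" "golden - y < golden \<Longrightarrow> (golden + 1) * 0 < y"
    for y :: real by auto
  from this(1)[OF *(2)[unfolded t]] this(2)[OF *(3)[unfolded t]] have F: "F = \<lfloor>(a + 2 * b + 1) * golden\<rfloor>"
    by (subst (asm) (1 2) mult_less_cancel_left_pos)
       (use golden_pos(1) in \<open>simp_all add: eq_commute[of F] floor_eq_iff del: golden_pos\<close>)
  \<comment> \<open>This combination of x and x' isolates a + 2b; the bounds on x and x' then
    exclude a + 2b \<le> -1.\<close>
  have "(a + 2 * b) * (golden - psi) = (2 - psi) * (a + b * golden) - (2 - golden) * (a + b * psi)"
    by (simp add: psi_def algebra_simps)
  moreover have "0 \<le> (2 - psi) * (a + b * golden)"
    using * psi_bounds by (intro mult_nonneg_nonneg) auto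
  moreover have "(2 - golden) * (a + b * psi) < (2 - golden) * golden"
    using * golden_bounds by simp
  ultimately have "(-1) * (golden - psi) < (a + 2 * b) * (golden - psi)"
    using golden_bounds psi_bounds by (simp add: algebra_simps)
  then have "-1 < real_of_int (a + 2 * b)"
    by (subst (asm) mult_less_cancel_right_pos) (use golden_bounds psi_bounds in auto)
  then have k: "0 \<le> a + 2 * b" by linarith
  then have r: "real (Suc (nat (a + 2 * b))) = of_int (a + 2 * b + 1)" by simp
  show "\<exists>k. a = 2 * \<lfloor>real (Suc k) * golden\<rfloor> - 3 * int (Suc k) + 1 \<and>
      b = 2 * int (Suc k) - 1 - \<lfloor>real (Suc k) * golden\<rfloor>"
    by (rule exI[of _ "nat (a + 2 * b)"], unfold r F[symmetric]) (use k in \<open>simp add: F_def\<close>)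
next
  assume "\<exists>k. a = 2 * \<lfloor>real (Suc k) * golden\<rfloor> - 3 * int (Suc k) + 1 \<and>
      b = 2 * int (Suc k) - 1 - \<lfloor>real (Suc k) * golden\<rfloor>"
  then obtain k where ab: "a = 2 * \<lfloor>real (Suc k) * golden\<rfloor> - 3 * int (Suc k) + 1"
      "b = 2 * int (Suc k) - 1 - \<lfloor>real (Suc k) * golden\<rfloor>" by blast
  define t where "t = real (Suc k) * golden - \<lfloor>real (Suc k) * golden\<rfloor>"
  have t: "0 < t" "t < 1"
    using frac_golden_pos[of "Suc k"] by (simp_all add: t_def) linarith
  have F: "real_of_int \<lfloor>real (Suc k) * golden\<rfloor> = real (Suc k) * golden - t"
    by (simp add: t_def)
  have ar: "real_of_int a = 2 * (real (Suc k) * golden - t) - 3 * real (Suc k) + 1"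
      "real_of_int b = 2 * real (Suc k) - 1 - (real (Suc k) * golden - t)"
    unfolding ab by (simp_all only: of_int_add of_int_diff of_int_mult of_int_of_nat_eq F)
  have "a + b * psi = golden - (golden + 1) * t"
    unfolding ar psi_def by (simp only: ring_distribs mult_1_left) (simp add: algebra_simps)
  moreover have "0 < (golden + 1) * t" "(golden + 1) * t < (golden + 1) * 1"
    using t by (intro mult_pos_pos mult_strict_left_mono; simp add: add_pos_pos)+
  ultimately have "-1 < a + b * psi \<and> a + b * psi < golden"
    by simp
  moreover have "0 \<le> a + b * golden"
  proof (cases "k = 0")
    case True
    have "\<lfloor>golden\<rfloor> = 1"
      using golden_bounds by (simp add: floor_eq_iff)
    then show ?thesis using True ab by simp
  next
    case False
    \<comment> \<open>From the second index on, each summand is nonnegative by the bounds on \<phi>;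
      the first index gave x = 0.\<close>
    have eq: "a + b * golden = (real k - 1) * (3 * golden - 4) + (6 * golden - 9)
        + (2 - golden) * (1 - t)"
      unfolding ar by (simp only: ring_distribs mult_1_left) (simp add: algebra_simps)
    show ?thesis
      unfolding eq by (intro add_nonneg_nonneg mult_nonneg_nonneg) (use False t golden_bounds in auto)
  qed
  ultimately show "0 \<le> a + b * golden \<and> -1 < a + b * psi \<and> a + b * psi < golden"
    by simp
qed

text \<open>With n = a + b the conjugate is \<phi> (n \<phi> - (a + 2b)), so [0, \<phi>) corresponds
  to [0, 1) for n \<phi> - (a + 2b). Here x = 0 has the index n = 0, which is the origin of
  V_0.\<close>

lemma nonneg_window_iff_floor:
  fixes a b :: int
  shows "0 \<le> a + b * golden \<and> 0 \<le> a + b * psi \<and> a + b * psi < golden \<longleftrightarrow>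
    (\<exists>n. a = 2 * int n - \<lfloor>real n * golden\<rfloor> \<and> b = \<lfloor>real n * golden\<rfloor> - int n)"
proof
  assume *: "0 \<le> a + b * golden \<and> 0 \<le> a + b * psi \<and> a + b * psi < golden"
  have t: "a + b * psi = golden * ((a + b) * golden - (a + 2 * b))"
    by (simp add: psi_def algebra_simps)
  have "golden * ((a + b) * golden - (a + 2 * b)) < golden * 1"
    "golden * 0 \<le> golden * ((a + b) * golden - (a + 2 * b))"
    using * unfolding t by simp_all
  then have "(a + b) * golden - (a + 2 * b) < 1" "0 \<le> (a + b) * golden - (a + 2 * b)"
    by (simp_all add: zero_le_mult_iff)
  then have F: "a + 2 * b = \<lfloor>(a + b) * golden\<rfloor>"
    by (simp add: eq_commute[of "a + 2 * b"] floor_eq_iff)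
  have "(a + b) * (golden - psi) = (1 - psi) * (a + b * golden) + (golden - 1) * (a + b * psi)"
    by (simp add: psi_def algebra_simps)
  moreover have "0 \<le> (1 - psi) * (a + b * golden)" "0 \<le> (golden - 1) * (a + b * psi)"
    using * psi_bounds golden_bounds by (intro mult_nonneg_nonneg; simp)+
  ultimately have "0 \<le> (a + b) * (golden - psi)" by simp
  then have n: "0 \<le> a + b"
    using golden_bounds psi_bounds by (simp add: zero_le_mult_iff)
  then have "real (nat (a + b)) = a + b" by simp
  with F n show "\<exists>n. a = 2 * int n - \<lfloor>real n * golden\<rfloor> \<and> b = \<lfloor>real n * golden\<rfloor> - int n"
    by (intro exI[of _ "nat (a + b)"]) simp
next
  assume "\<exists>n. a = 2 * int n - \<lfloor>real n * golden\<rfloor> \<and> b = \<lfloor>real n * golden\<rfloor> - int n"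
  then obtain n where ab: "a = 2 * int n - \<lfloor>real n * golden\<rfloor>"
    "b = \<lfloor>real n * golden\<rfloor> - int n" by blast
  have "a + b * psi = golden * (real n * golden - \<lfloor>real n * golden\<rfloor>)"
    unfolding ab by (simp add: psi_def algebra_simps)
  moreover have "0 \<le> golden * (real n * golden - \<lfloor>real n * golden\<rfloor>)"
    "golden * (real n * golden - \<lfloor>real n * golden\<rfloor>) < golden * 1"
    by (simp, intro mult_strict_left_mono, linarith, simp)
  moreover have "a + b * golden = real n * (2 - golden) + \<lfloor>real n * golden\<rfloor> * (golden - 1)"
    unfolding ab by (simp add: algebra_simps)
  moreover have "0 \<le> real n * (2 - golden)" "0 \<le> \<lfloor>real n * golden\<rfloor> * (golden - 1)"
    using golden_bounds by (intro mult_nonneg_nonneg; simp)+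
  ultimately show "0 \<le> a + b * golden \<and> 0 \<le> a + b * psi \<and> a + b * psi < golden"
    by simp
qed

lemma strict_mono_beatty0:
  assumes "0 \<le> p" "0 < q"
  shows "strict_mono (beatty0 p q r)"
  unfolding strict_mono_Suc_iff
proof
  fix n
  have "\<lfloor>real n * golden\<rfloor> \<le> \<lfloor>real (Suc n) * golden\<rfloor>"
    by (intro floor_mono mult_right_mono) auto
  then have "p * \<lfloor>real n * golden\<rfloor> \<le> p * \<lfloor>real (Suc n) * golden\<rfloor>"
    using assms by (intro mult_left_mono)
  with assms show "beatty0 p q r n < beatty0 p q r (Suc n)"
    by (simp add: beatty0_def algebra_simps)
qed

lemma strict_mono_beatty1:
  assumes "0 \<le> p" "0 < q"
  shows "strict_mono (beatty1 p q r)"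
  using strict_mono_beatty0[OF assms, of r] by (auto simp: strict_mono_def beatty1_def)

section \<open>Traces of integral parts\<close>

lemma trace_append:
  fixes a b :: int
  assumes "val golden cs = a + b * golden"
  shows "val golden (vs @ cs) + val psi (vs @ cs) =
    val golden vs + val psi vs + a * lucas (length vs) + b * lucas (Suc (length vs))"
  \<comment> \<open>The string \<open>cs\<close> is multiplied by \<phi>^n with n =
    \<open>length vs\<close>; the traces of \<phi>^n and \<phi>^(n+1) are Lucas numbers.\<close>
  unfolding horner_sum_append assms val_golden_eq_imp_val_psi_eq[OF assms]
  by (simp add: lucas_binet algebra_simps del: lucas.simps)

lemma trace_int: "\<exists>t :: int. val golden xs + val psi xs = t"
proof -
  obtain a b :: int where "val golden xs = a + b * golden"
    using val_in_golden_ring by blast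
  from trace_append[OF this, of "[]"] show ?thesis
    by (intro exI[of _ "2 * a + b"]) simp
qed

text \<open>The fractional part of \<open>N\<close> differs from the conjugate of its integral part by an integer,
  so it is determined by that conjugate.\<close>

lemma between_val_iff:
  fixes N :: nat
  assumes "1 \<le> val psi xs" "val psi xs < golden"
  shows "val golden xs \<le> N \<and> N < val golden xs + golden - 1 \<longleftrightarrow>
    N = val golden xs + val psi xs - 1"
proof
  assume *: "val golden xs \<le> N \<and> N < val golden xs + golden - 1"
  obtain t :: int where t: "val golden xs + val psi xs = t" using trace_int by blast
  then have "real_of_int (-1) < of_int (int N - t + 1)" "of_int (int N - t + 1) < real_of_int 1"
    using * assms golden_bounds by simp_all
  then have "int N - t + 1 = 0"
    unfolding of_int_less_iff by linarith
  then have "real N = t - 1" by linarith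
  then show "N = val golden xs + val psi xs - 1" using t by simp
qed (use assms in auto)

text \<open>N minus the trace would be an integer strictly between -1 and 0, as the fractional part
  of N, below \<phi> - 1, cannot reach the conjugate.\<close>

lemma not_between_val:
  fixes N :: nat
  assumes "golden - 1 \<le> val psi xs" "val psi xs < 1"
  shows "\<not> (val golden xs \<le> N \<and> N < val golden xs + golden - 1)"
proof
  assume *: "val golden xs \<le> N \<and> N < val golden xs + golden - 1"
  obtain t :: int where t: "val golden xs + val psi xs = t" using trace_int by blast
  then have "real_of_int (-1) < of_int (int N - t)" "of_int (int N - t) < real_of_int 0"
    using * assms by simp_all
  then show False
    unfolding of_int_less_iff by linarith
qed

lemma exists_nat_trace:
  assumes "1 \<le> val psi xs"
  shows "\<exists>N :: nat. real N = val golden xs + val psi xs - 1"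
proof -
  obtain t :: int where t: "val golden xs + val psi xs = t" using trace_int by blast
  then have "1 \<le> t" using assms val_golden_nonneg[of xs] by linarith
  then show ?thesis using t by (intro exI[of _ "nat (t - 1)"]) simp
qed

section \<open>Conjugates after a run of zeros\<close>

lemma psi_power_even: "0 < psi ^ (2 * Suc j)" "psi ^ (2 * Suc j) \<le> psi + 1"
proof -
  have eq: "psi ^ (2 * Suc j) = (psi + 1) * (psi + 1) ^ j"
    by (simp only: power_mult power2_eq_square psi_mult_psi power_Suc)
  have "(psi + 1) ^ j \<le> 1"
    using psi_bounds by (intro power_le_one) auto
  then show "0 < psi ^ (2 * Suc j)" "psi ^ (2 * Suc j) \<le> psi + 1"
    unfolding eq using psi_bounds by (simp_all add: mult_left_le)
qed

text \<open>If the digits at positions 1 to 2j + 1 are 0 and the last digit is 1, the conjugate is 1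
  + \<psi>^(2j+2) y with y from the digits further left. The upper bound comes from 1 + \<psi>^2
  \<phi> = \<phi>.\<close>

lemma even_window:
  assumes "0 \<le> y" "y < golden"
  shows "1 \<le> 1 + psi ^ (2 * Suc j) * y" "1 + psi ^ (2 * Suc j) * y < golden"
proof -
  show "1 \<le> 1 + psi ^ (2 * Suc j) * y"
    using psi_power_even[of j] assms by (simp del: mult_Suc_right)
  have "psi ^ (2 * Suc j) * y \<le> (psi + 1) * y"
    using psi_power_even[of j] assms by (intro mult_right_mono)
  also have "\<dots> < (psi + 1) * golden"
    using assms psi_bounds by simp
  also have "\<dots> = golden - 1" by (simp add: algebra_simps)
  finally show "1 + psi ^ (2 * Suc j) * y < golden" by simp
qed

text \<open>From y > -1 and \<psi>^(2j+2) \<le> \<psi>^2 = 2 - \<phi>, a negative y leads to the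
  zone where no N exists.\<close>

lemma even_window_neg:
  assumes "-1 < y" "y < 0"
  shows "golden - 1 \<le> 1 + psi ^ (2 * Suc j) * y" "1 + psi ^ (2 * Suc j) * y < 1"
proof -
  have "psi ^ (2 * Suc j) * (-1) \<le> psi ^ (2 * Suc j) * y"
    using psi_power_even[of j] assms by (intro mult_left_mono) auto
  then show "golden - 1 \<le> 1 + psi ^ (2 * Suc j) * y"
    using psi_power_even[of j] psi_def by simp
  show "1 + psi ^ (2 * Suc j) * y < 1"
    using psi_power_even[of j] assms by (simp add: mult_pos_neg del: mult_Suc_right)
qed

text \<open>The leading 0 leaves the digits \<open>cs\<close> above the block free, so they run over
  the whole enumerated window. Every \<open>cs\<close> yields an N, namely the trace minus 1, and
  the trace is a Beatty expression in the index.\<close>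

lemma is_R_beatty1:
  assumes w: "admissible w" "3 \<le> length w" "hd w = 0" "last w = 1"
    and window: "\<And>cs. admissible cs \<Longrightarrow> 1 \<le> val psi (rev w @ cs) \<and> val psi (rev w @ cs) < golden"
    and \<gamma>: "of_int \<gamma> = val golden (rev w) + val psi (rev w) - 1 - lucas (length w - 1)"
  shows "is_R w (beatty1 (lucas (length w - 2)) (lucas (length w - 3)) \<gamma>)"
proof -
  have ne: "w \<noteq> []" using w by auto
  obtain j where len: "length w = Suc (Suc (Suc j))"
    using w(2) by (metis add.commute le_Suc_ex numeral_3_eq_3 plus_nat.simps(2) plus_nat.simps(1))
  have block: "phi_block (length w) N = w \<longleftrightarrow>
      (\<exists>cs. admissible cs \<and> N = val golden (rev w @ cs) + val psi (rev w @ cs) - 1)" for N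
  proof -
    have "admissible (rev w @ cs) \<longleftrightarrow> admissible cs" for cs
      using w(1,3) ne by (simp add: admissible_append_iff last_rev)
    then show ?thesis
      unfolding phi_block_eq_iff[OF ne w(4)] using between_val_iff window by blast
  qed
  have trace: "val golden (rev w @ cs) + val psi (rev w @ cs) - 1 =
      beatty1 (lucas (length w - 2)) (lucas (length w - 3)) \<gamma> k"
    if "val golden cs = a + b * golden"
      "a = 2 * \<lfloor>real (Suc k) * golden\<rfloor> - 3 * int (Suc k) + 1"
      "b = 2 * int (Suc k) - 1 - \<lfloor>real (Suc k) * golden\<rfloor>" for a b :: int and cs k
  proof -
    define F where "F = \<lfloor>real (Suc k) * golden\<rfloor>"
    \<comment> \<open>With m = \<open>length w\<close>: 2 L_m - L_(m+1) = L_(m-2), 2 L_(m+1) - 3 L_m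
      = L_(m-3), and the constant L_m - L_(m+1) = -L_(m-1) goes into \<gamma>.\<close>
    have "a * lucas (length w) + b * lucas (Suc (length w)) + lucas (length w - 1)
        = F * lucas (length w - 2) + int (Suc k) * lucas (length w - 3)"
      unfolding that(2,3) F_def[symmetric] len by (simp add: algebra_simps)
    then have "real_of_int (a * lucas (length w) + b * lucas (Suc (length w)) + lucas (length w - 1))
        = real_of_int (F * lucas (length w - 2) + int (Suc k) * lucas (length w - 3))"
      by simp
    then show ?thesis
      using trace_append[OF that(1), of "rev w"] \<gamma>
      by (simp add: beatty1_def beatty0_def F_def mult.commute)
  qed
  have "range (beatty1 (lucas (length w - 2)) (lucas (length w - 3)) \<gamma>)
      = int ` {N. phi_block (length w) N = w}"
  proof (intro equalityI subsetI)
    fix x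
    assume "x \<in> range (beatty1 (lucas (length w - 2)) (lucas (length w - 3)) \<gamma>)"
    then obtain k where x: "x = beatty1 (lucas (length w - 2)) (lucas (length w - 3)) \<gamma> k" by blast
    define a b where "a = 2 * \<lfloor>real (Suc k) * golden\<rfloor> - 3 * int (Suc k) + 1"
      and "b = 2 * int (Suc k) - 1 - \<lfloor>real (Suc k) * golden\<rfloor>"
    then obtain cs where cs: "admissible cs" "val golden cs = a + b * golden"
      using admissible_val_iff window_iff_floor by blast
    obtain N :: nat where N: "real N = val golden (rev w @ cs) + val psi (rev w @ cs) - 1"
      using exists_nat_trace window[OF cs(1)] by blast
    with trace[OF cs(2) a_def b_def] have "real N = x" by (simp add: x)
    then have "x = int N" by linarith
    moreover have "phi_block (length w) N = w"
      using block cs(1) N by blast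
    ultimately show "x \<in> int ` {N. phi_block (length w) N = w}" by blast
  next
    fix x
    assume "x \<in> int ` {N. phi_block (length w) N = w}"
    then obtain N cs where N: "x = int N" "admissible cs"
        "N = val golden (rev w @ cs) + val psi (rev w @ cs) - 1"
      using block by blast
    obtain a b :: int where ab: "val golden cs = a + b * golden"
      using val_in_golden_ring by blast
    then obtain k where k: "a = 2 * \<lfloor>real (Suc k) * golden\<rfloor> - 3 * int (Suc k) + 1"
        "b = 2 * int (Suc k) - 1 - \<lfloor>real (Suc k) * golden\<rfloor>"
      using N(2) admissible_val_iff window_iff_floor by metis
    have "real_of_int x = beatty1 (lucas (length w - 2)) (lucas (length w - 3)) \<gamma> k"
      using trace[OF ab k] N by simp
    then show "x \<in> range (beatty1 (lucas (length w - 2)) (lucas (length w - 3)) \<gamma>)"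
      by (metis of_int_eq_iff rangeI)
  qed
  then show ?thesis
    using strict_mono_beatty1 lucas_pos by (simp add: is_R_def less_le_trans[OF zero_less_one] order_trans[OF zero_le_one])
qed

section \<open>Changing the leading digit of a block\<close>

lemma phi_block_Suc: "phi_block (Suc m) N = phi_digit N (int m) # phi_block m N"
  by (simp add: phi_block_def)

lemma phi_digit_01: "phi_digit N i = 0 \<or> phi_digit N i = 1"
  using is_base_phi_phi_digit[of N] by (auto simp: is_base_phi_def)

text \<open>Since 1w never occurs, each occurrence of w is preceded by 0. This carries results for
  words with a leading 0 over to w.\<close>

lemma is_R_Cons_0_iff:
  assumes "\<nexists>N. phi_block (Suc (length w)) N = 1 # w"
  shows "is_R (0 # w) s \<longleftrightarrow> is_R w s"
proof -
  have "phi_block (length (0 # w)) N = 0 # w \<longleftrightarrow> phi_block (length w) N = w" for N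
    using assms phi_digit_01[of N "int (length w)"] by (auto simp: phi_block_Suc)
  then show ?thesis by (simp add: is_R_def)
qed

lemma not_phi_block_11: "phi_block (Suc (Suc (length w))) N \<noteq> 1 # 1 # w"
proof
  assume "phi_block (Suc (Suc (length w))) N = 1 # 1 # w"
  then have "phi_digit N (int (length w)) * phi_digit N (int (length w) + 1) = 1"
    by (simp add: phi_block_Suc algebra_simps)
  moreover have "phi_digit N (int (length w)) * phi_digit N (int (length w) + 1) = 0"
    using is_base_phi_phi_digit[of N] unfolding is_base_phi_def by blast
  ultimately show False by simp
qed

section \<open>Words with suffix 101\<close>

lemma admissible_if_not_sublist_11:
  assumes "set w \<subseteq> {0, 1}" "\<not> sublist [1, 1] w"
  shows "admissible w"
proof -
  have "successively (\<lambda>a b. a * b = 0) w"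
    using assms
    by (induction w rule: induct_list012) (auto simp: sublist_Cons_right)
  with assms show ?thesis by (simp add: admissible_iff)
qed

lemma ends_101_cases:
  assumes "admissible w" "2 \<le> length w" "last w = 1" "w \<noteq> [0, 1]"
    and "\<not> suffix [0, 0, 1] w"
  obtains v where "w = v @ [1, 0, 1]"
proof -
  obtain v b where w: "w = v @ [b, 1]"
  proof -
    obtain u where u: "w = u @ [1]"
      using assms(2,3) by (metis append_butlast_last_id list.size(3) not_numeral_le_zero)
    then obtain v b where "u = v @ [b]"
      using assms(2) by (cases u rule: rev_cases) auto
    with u show thesis by (intro that[of v b]) simp
  qed
  have b: "b = 0"
    using assms(1) by (simp add: w admissible_iff successively_append_iff)
  then have "v \<noteq> []" using assms(4) w by auto
  then obtain u a where v: "v = u @ [a]" by (cases v rule: rev_cases) auto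
  have "a \<noteq> 0"
    using assms(5) by (auto simp: w v b suffix_def)
  moreover have "a \<in> {0, 1}"
    using assms(1) by (auto simp: w v admissible_iff)
  ultimately show thesis
    using that[of u] by (simp add: w v b)
qed

text \<open>The conjugate is 1 + \<psi>^2 y, where y belongs to a string with lowest digit 1, so y >
  \<phi> - 1 > 0.\<close>

lemma window_101:
  assumes "admissible (v @ [1, 0, 1])" "v \<noteq> []" "hd v = 0" "admissible cs"
  shows "1 \<le> val psi (rev (v @ [1, 0, 1]) @ cs) \<and> val psi (rev (v @ [1, 0, 1]) @ cs) < golden"
proof -
  have "admissible (1 # rev v @ cs)"
  proof -
    have "admissible (rev (v @ [1]))"
      using assms(1) by (simp only: admissible_rev admissible_append_iff[of v]) (simp add: admissible_iff)
    then show ?thesis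
      using assms admissible_append_iff[of "rev (v @ [1])" cs] by (simp add: last_rev)
  qed
  then have "0 \<le> val psi (1 # rev v @ cs)" "val psi (1 # rev v @ cs) < golden"
    using val_psi_Cons_1[of "rev v @ cs"] val_psi_bounds(2)[of "1 # rev v @ cs"] golden_bounds
    by simp_all
  note even_window[OF this, of 0]
  moreover have "val psi (rev (v @ [1, 0, 1]) @ cs)
      = 1 + psi ^ (2 * Suc 0) * val psi (1 # rev v @ cs)"
    by (simp add: power2_eq_square distrib_right)
  ultimately show ?thesis by simp
qed

text \<open>Combine x < \<phi>^n, x' < \<phi> and L_n = \<phi>^n + \<psi>^n; for n \<ge> 2 one has
  \<psi>^n \<ge> -\<psi>^2 = \<phi> - 2.\<close>

lemma trace_bound:
  assumes "admissible xs" "2 \<le> length xs"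
  shows "val golden xs + val psi xs < lucas (length xs) + 2"
proof -
  have "\<bar>psi\<bar> ^ length xs \<le> \<bar>psi\<bar> ^ 2"
    using psi_bounds assms by (intro power_decreasing) auto
  then have "\<bar>psi ^ length xs\<bar> \<le> psi + 1"
    by (simp add: power_abs power2_eq_square)
  then have "golden - 2 \<le> psi ^ length xs"
    using psi_def by linarith
  then show ?thesis
    using val_golden_less[OF assms(1)] val_psi_bounds(2)[OF assms(1)] by (simp add: lucas_binet)
qed

lemma is_R_ends_101:
  assumes "admissible (v @ [1, 0, 1])" "v \<noteq> []" "hd v = 0"
  defines "w \<equiv> v @ [1, 0, 1]"
  shows "\<exists>\<gamma> \<le> 0. is_R w (beatty1 (lucas (length w - 2)) (lucas (length w - 3)) \<gamma>)"
proof -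
  obtain u where v: "v = 0 # u" using assms(2,3) by (cases v) auto
  obtain t :: int where t: "val golden (rev w) + val psi (rev w) = t" using trace_int by blast
  define \<gamma> where "\<gamma> = t - 1 - lucas (length w - 1)"
  have "is_R w (beatty1 (lucas (length w - 2)) (lucas (length w - 3)) \<gamma>)"
    by (rule is_R_beatty1) (use assms window_101[of v] t in \<open>auto simp: \<gamma>_def w_def\<close>)
  moreover have "\<gamma> \<le> 0"
  proof -
    \<comment> \<open>Dropping the leading 0 keeps the trace but shortens the word by one, so the
      trace is at most 1 + \<open>lucas (length w - 1)\<close>, which is what \<gamma>
      subtracts.\<close>
    define xs where "xs = rev (u @ [1, 0, 1])"
    have "admissible (u @ [1, 0, 1])" using assms(1) v by simp
    then have "admissible xs" unfolding xs_def admissible_rev .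
    then have "val golden xs + val psi xs < lucas (length xs) + 2"
      by (rule trace_bound) (simp add: xs_def)
    moreover have "rev w = xs @ [0]" by (simp add: w_def v xs_def)
    then have "val golden xs + val psi xs = t"
      using t by (simp add: horner_sum_append)
    moreover have "length xs = length w - 1" by (simp add: w_def v xs_def)
    ultimately have "real_of_int t < of_int (lucas (length w - 1) + 2)" by simp
    then show ?thesis unfolding of_int_less_iff by (simp add: \<gamma>_def)
  qed
  ultimately show ?thesis by blast
qed

section \<open>Words ending in a run of zeros and a 1\<close>

lemma not_phi_block_1_even_0_1:
  assumes "1 \<le> m"
  shows "phi_block (2 * m + 2) N \<noteq> [1] @ replicate (2 * m) 0 @ [1]"
proof
  let ?w = "[1] @ replicate (2 * m) 0 @ [1 :: nat]"
  assume "phi_block (2 * m + 2) N = ?w"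
  then have "phi_block (length ?w) N = ?w" by simp
  then obtain cs where cs: "admissible (rev ?w @ cs)" "val golden (rev ?w @ cs) \<le> N"
      "N < val golden (rev ?w @ cs) + golden - 1"
    by (subst (asm) phi_block_eq_iff) auto
  have rev: "rev ?w @ cs = (1 # replicate (2 * m) 0) @ 1 # cs" by simp
  have adm: "admissible (1 # cs)"
    using cs(1) unfolding rev admissible_append_iff by blast
  define y where "y = - (psi * val psi (1 # cs))"
  have "golden - 1 < val psi (1 # cs)" "val psi (1 # cs) < golden"
    using val_psi_Cons_1[of cs] val_psi_bounds(2)[OF adm] adm by simp_all
  \<comment> \<open>The second 1 stands at the odd position 2m + 1. One factor \<psi> split off its
    power makes the positive conjugate of \<open>1 # cs\<close> negative, and the remaining power is
    even.\<close>
  then have "psi * golden < psi * val psi (1 # cs)" "psi * val psi (1 # cs) < psi * 0"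
    using psi_bounds golden_bounds by (intro mult_strict_left_mono_neg; simp)+
  then have "-1 < psi * val psi (1 # cs)" "psi * val psi (1 # cs) < 0"
    by simp_all
  from even_window_neg[OF this] have
    "golden - 1 \<le> 1 + psi ^ (2 * m) * (psi * val psi (1 # cs))"
    "1 + psi ^ (2 * m) * (psi * val psi (1 # cs)) < 1"
    using assms by (metis Suc_diff_1 less_eq_Suc_le One_nat_def)+
  moreover have "val psi (rev ?w @ cs) = 1 + psi ^ (2 * m) * (psi * val psi (1 # cs))"
    unfolding rev horner_sum_append by (simp add: algebra_simps)
  ultimately have "golden - 1 \<le> val psi (rev ?w @ cs)" "val psi (rev ?w @ cs) < 1"
    by (simp_all only:)
  from not_between_val[OF this] cs(2,3) show False by blast
qed

text \<open>The conjugate is 1 + \<psi>^(2m+2) y with y the conjugate of \<open>cs\<close>, so an N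
  exists exactly for y \<ge> 0, and these \<open>cs\<close> are enumerated from n = 0 on.\<close>

lemma is_R_odd_0_1:
  "is_R (replicate (2 * m + 1) 0 @ [1]) (beatty0 (lucas (2 * m + 1)) (lucas (2 * m)) 1)"
proof -
  let ?w = "replicate (2 * m + 1) 0 @ [1 :: nat]"
  let ?s = "beatty0 (lucas (2 * m + 1)) (lucas (2 * m)) 1"
  have rev: "rev ?w = 1 # replicate (2 * m + 1) 0" by (simp add: replicate_append_same)
  have adm: "admissible (rev ?w @ cs) \<longleftrightarrow> admissible cs" for cs
    unfolding rev by simp
  have val: "val psi (rev ?w @ cs) = 1 + psi ^ (2 * Suc m) * val psi cs" for cs
    unfolding rev horner_sum_append by simp
  have block: "phi_block (length ?w) N = ?w \<longleftrightarrow>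
      (\<exists>cs. admissible cs \<and> 0 \<le> val psi cs \<and>
        N = val golden (rev ?w @ cs) + val psi (rev ?w @ cs) - 1)" for N
  proof -
    have "val golden (rev ?w @ cs) \<le> N \<and> N < val golden (rev ?w @ cs) + golden - 1 \<longleftrightarrow>
        0 \<le> val psi cs \<and> N = val golden (rev ?w @ cs) + val psi (rev ?w @ cs) - 1"
      if "admissible cs" for cs
    proof (cases "0 \<le> val psi cs")
      case True
      then show ?thesis
        using even_window[OF True, of m] val_psi_bounds(2)[OF that] val[of cs]
          between_val_iff[of "rev ?w @ cs" N] by simp
    next
      case False
      then show ?thesis
        using even_window_neg[of "val psi cs" m] val_psi_bounds(1)[OF that] val[of cs]
          not_between_val[of "rev ?w @ cs" N] by simp
    qed
    then show ?thesis
      by (subst phi_block_eq_iff) (auto simp only: adm, auto)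
  qed
  have trace: "val golden (rev ?w @ cs) + val psi (rev ?w @ cs) - 1 = ?s n"
    if "val golden cs = a + b * golden" "a = 2 * int n - \<lfloor>real n * golden\<rfloor>"
      "b = \<lfloor>real n * golden\<rfloor> - int n" for a b :: int and cs n
  proof -
    define F where "F = \<lfloor>real n * golden\<rfloor>"
    have len: "length (rev ?w) = Suc (Suc (2 * m))" by simp
    \<comment> \<open>Uses L_(2m+3) - L_(2m+2) = L_(2m+1) and 2 L_(2m+2) - L_(2m+3) =
      L_(2m).\<close>
    have "a * lucas (Suc (Suc (2 * m))) + b * lucas (Suc (Suc (Suc (2 * m))))
        = F * lucas (2 * m + 1) + int n * lucas (2 * m)"
      unfolding that(2,3) F_def[symmetric] by (simp add: algebra_simps)
    then have "real_of_int (a * lucas (Suc (Suc (2 * m))) + b * lucas (Suc (Suc (Suc (2 * m)))))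
        = real_of_int (F * lucas (2 * m + 1) + int n * lucas (2 * m))"
      by simp
    moreover have "val golden (rev ?w) + val psi (rev ?w) = 2"
      unfolding rev by simp
    ultimately show ?thesis
      using trace_append[OF that(1), of "rev ?w"] unfolding len
      by (simp only: beatty0_def F_def) (simp add: mult.commute)
  qed
  have "range ?s = int ` {N. phi_block (length ?w) N = ?w}"
  proof (intro equalityI subsetI)
    fix x
    assume "x \<in> range ?s"
    then obtain n where x: "x = ?s n" by blast
    define a b where "a = 2 * int n - \<lfloor>real n * golden\<rfloor>" and "b = \<lfloor>real n * golden\<rfloor> - int n"
    then have win: "0 \<le> a + b * golden \<and> 0 \<le> a + b * psi \<and> a + b * psi < golden"
      using nonneg_window_iff_floor by blast
    then obtain cs where cs: "admissible cs" "val golden cs = a + b * golden"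
      using admissible_val_iff[of a b] by auto
    then have nonneg: "0 \<le> val psi cs"
      using val_golden_eq_imp_val_psi_eq[OF cs(2)] win by simp
    obtain N :: nat where N: "real N = val golden (rev ?w @ cs) + val psi (rev ?w @ cs) - 1"
      using exists_nat_trace[of "rev ?w @ cs"] even_window(1)[OF nonneg, of m]
        val_psi_bounds(2)[OF cs(1)] val[of cs] by metis
    with trace[OF cs(2) a_def b_def] have "real N = x" by (simp add: x)
    then have "x = int N" by linarith
    moreover have "phi_block (length ?w) N = ?w"
      using block cs(1) nonneg N by blast
    ultimately show "x \<in> int ` {N. phi_block (length ?w) N = ?w}" by blast
  next
    fix x
    assume "x \<in> int ` {N. phi_block (length ?w) N = ?w}"
    then obtain N cs where N: "x = int N" "admissible cs" "0 \<le> val psi cs"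
        "N = val golden (rev ?w @ cs) + val psi (rev ?w @ cs) - 1"
      using block by blast
    obtain a b :: int where ab: "val golden cs = a + b * golden"
      using val_in_golden_ring by blast
    then have "0 \<le> a + b * golden \<and> 0 \<le> a + b * psi \<and> a + b * psi < golden"
      using N(2,3) admissible_val_iff[of a b] val_golden_eq_imp_val_psi_eq[OF ab] by auto
    then obtain n where n: "a = 2 * int n - \<lfloor>real n * golden\<rfloor>" "b = \<lfloor>real n * golden\<rfloor> - int n"
      using nonneg_window_iff_floor by blast
    have "real_of_int x = ?s n"
      using trace[OF ab n] N by simp
    then show "x \<in> range ?s"
      by (metis of_int_eq_iff rangeI)
  qed
  then show ?thesis
    using strict_mono_beatty0[of "lucas (2 * m + 1)" "lucas (2 * m)" 1]
      lucas_pos[of "2 * m + 1"] lucas_pos[of "2 * m"]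
    by (simp only: is_R_def)
qed

text \<open>A 0 is put in front, which is forced since 11 never occurs. The upper 1 stands at the
  even position 2m + 2 and the string from it on has a positive conjugate, so every continuation is
  allowed.\<close>

lemma is_R_1_odd_0_1:
  "is_R ([1] @ replicate (2 * m + 1) 0 @ [1])
     (beatty1 (lucas (2 * m + 2)) (lucas (2 * m + 1)) (- lucas (2 * m + 1) + 1))"
proof -
  let ?v = "[1] @ replicate (2 * m + 1) 0 @ [1 :: nat]"
  let ?w = "0 # ?v"
  have rev: "rev ?w = (1 # replicate (2 * m + 1) 0) @ [1, 0]"
    by (simp add: replicate_append_same)
  have adm_w: "admissible ?w"
    by (auto simp: admissible_iff successively_conv_nth nth_Cons nth_append split: nat.splits)
  have "is_R ?w (beatty1 (lucas (length ?w - 2)) (lucas (length ?w - 3)) (- lucas (2 * m + 1) + 1))"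
  proof (rule is_R_beatty1)
    fix cs
    assume "admissible cs"
    then have adm: "admissible (1 # 0 # cs)" by (rule admissible.OneZero)
    then have "0 \<le> val psi (1 # 0 # cs)" "val psi (1 # 0 # cs) < golden"
      using val_psi_Cons_1[of "0 # cs"] val_psi_bounds(2)[OF adm] golden_bounds by auto
    note even_window[OF this, of m]
    moreover have "val psi (rev ?w @ cs) = 1 + psi ^ (2 * Suc m) * val psi (1 # 0 # cs)"
      unfolding rev append_assoc horner_sum_append[of _ _ "1 # _"] by (simp add: distrib_right)
    ultimately show "1 \<le> val psi (rev ?w @ cs) \<and> val psi (rev ?w @ cs) < golden" by simp
  next
    \<comment> \<open>The digits 1 at positions 0 and 2m + 2 have traces 2 and L_(2m+2); subtracting
      1 and L_(2m+3) leaves 1 - L_(2m+1).\<close>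
    have "val golden (rev ?w) + val psi (rev ?w) = 2 + lucas (Suc (Suc (2 * m)))"
      unfolding rev horner_sum_append by (simp add: lucas_binet del: lucas.simps)
    then show "of_int (- lucas (2 * m + 1) + 1) =
        val golden (rev ?w) + val psi (rev ?w) - 1 - lucas (length ?w - 1)"
      by simp
  qed (use adm_w in auto)
  then have "is_R ?w (beatty1 (lucas (2 * m + 2)) (lucas (2 * m + 1)) (- lucas (2 * m + 1) + 1))"
    by simp
  moreover have "is_R ?w s \<longleftrightarrow> is_R ?v s" for s
    using not_phi_block_11[of "replicate (2 * m + 1) 0 @ [1]"] by (intro is_R_Cons_0_iff) simp
  ultimately show ?thesis by blast
qed

text \<open>As 10^(2m)1 never occurs, the word has the same occurrences as 0^(2m+1)1.\<close>

lemma is_R_even_0_1: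
  assumes "1 \<le> m"
  shows "is_R (replicate (2 * m) 0 @ [1]) (beatty0 (lucas (2 * m + 1)) (lucas (2 * m)) 1)"
proof -
  have "is_R (0 # replicate (2 * m) 0 @ [1]) s \<longleftrightarrow> is_R (replicate (2 * m) 0 @ [1]) s" for s
    using not_phi_block_1_even_0_1[OF assms] by (intro is_R_Cons_0_iff) simp
  then show ?thesis using is_R_odd_0_1[of m] by (simp add: replicate_append_same)
qed

text \<open>In the first part the word ends in 101. If it starts with 1, a 0 is prepended: the
  occurrences stay the same, while the length and with it both Lucas indices grow by one. For 01 the
  index m - 3 would be negative; that word is the case m = 0 of 0^(2m+1)1.\<close>

theorem theorem6p6:
  shows
    "(\<forall>(m::nat) (w::nat list).
        m \<ge> 2 \<and> length w = m \<and> set w \<subseteq> {0, 1} \<and> \<not> sublist [1, 1] w \<and> last w = 1 \<and>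
        w \<noteq> [0, 1] \<and>
        \<not> (\<exists>k\<ge>2. suffix (replicate k 0 @ [1]) w \<or> suffix ([1] @ replicate k 0 @ [1]) w)
        \<longrightarrow> (\<exists>\<gamma>::int. \<gamma> \<le> 0 \<and>
              (hd w = 0 \<longrightarrow> is_R w (beatty1 (lucas (m - 2)) (lucas (m - 3)) \<gamma>)) \<and>
              (hd w = 1 \<longrightarrow> is_R w (beatty1 (lucas (m - 1)) (lucas (m - 2)) \<gamma>)))) \<and>
     (\<forall>m::nat. m \<ge> 1 \<longrightarrow>
        is_R (replicate (2 * m) 0 @ [1]) (beatty0 (lucas (2 * m + 1)) (lucas (2 * m)) 1) \<and>
        is_R (replicate (2 * m + 1) 0 @ [1]) (beatty0 (lucas (2 * m + 1)) (lucas (2 * m)) 1) \<and>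
        \<not> (\<exists>N. phi_block (2 * m + 2) N = [1] @ replicate (2 * m) 0 @ [1]) \<and>
        is_R ([1] @ replicate (2 * m + 1) 0 @ [1])
          (beatty1 (lucas (2 * m + 2)) (lucas (2 * m + 1)) (- lucas (2 * m + 1) + 1)))"
proof (rule conjI; intro allI impI)
  fix m :: nat and w :: "nat list"
  assume *: "m \<ge> 2 \<and> length w = m \<and> set w \<subseteq> {0, 1} \<and> \<not> sublist [1, 1] w \<and> last w = 1 \<and>
        w \<noteq> [0, 1] \<and>
        \<not> (\<exists>k\<ge>2. suffix (replicate k 0 @ [1]) w \<or> suffix ([1] @ replicate k 0 @ [1]) w)"
  then have adm: "admissible w" by (intro admissible_if_not_sublist_11) auto
  have "\<not> suffix (replicate 2 0 @ [1]) w" using * by blast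
  then have "\<not> suffix [0, 0, 1] w" by (simp add: numeral_2_eq_2)
  then obtain v where v: "w = v @ [1, 0, 1]"
    using ends_101_cases[OF adm] * by metis
  show "\<exists>\<gamma>::int. \<gamma> \<le> 0 \<and>
      (hd w = 0 \<longrightarrow> is_R w (beatty1 (lucas (m - 2)) (lucas (m - 3)) \<gamma>)) \<and>
      (hd w = 1 \<longrightarrow> is_R w (beatty1 (lucas (m - 1)) (lucas (m - 2)) \<gamma>))"
  proof (cases "hd w = 0")
    case True
    then have "v \<noteq> []" "hd v = 0" by (auto simp: v hd_append split: if_splits)
    with is_R_ends_101[of v] adm True * show ?thesis
      unfolding v by (metis zero_neq_one)
  next
    case False
    have "admissible ((0 # v) @ [1, 0, 1])"
      using adm v by simp
    from is_R_ends_101[OF this] obtain \<gamma> where \<gamma>: "\<gamma> \<le> 0"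
      "is_R (0 # w) (beatty1 (lucas (m - 1)) (lucas (m - 2)) \<gamma>)"
      using * v by auto
    moreover have "is_R (0 # w) s \<longleftrightarrow> is_R w s" if "hd w = 1" for s
    proof (rule is_R_Cons_0_iff)
      have "w \<noteq> []" using v by simp
      with that obtain u where "w = 1 # u" by (metis list.collapse)
      then show "\<nexists>N. phi_block (Suc (length w)) N = 1 # w"
        using not_phi_block_11[of u] by simp
    qed
    ultimately show ?thesis using False by auto
  qed
next
  fix m :: nat
  assume m: "m \<ge> 1"
  then show "is_R (replicate (2 * m) 0 @ [1]) (beatty0 (lucas (2 * m + 1)) (lucas (2 * m)) 1) \<and>
      is_R (replicate (2 * m + 1) 0 @ [1]) (beatty0 (lucas (2 * m + 1)) (lucas (2 * m)) 1) \<and>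
      \<not> (\<exists>N. phi_block (2 * m + 2) N = [1] @ replicate (2 * m) 0 @ [1]) \<and>
      is_R ([1] @ replicate (2 * m + 1) 0 @ [1])
        (beatty1 (lucas (2 * m + 2)) (lucas (2 * m + 1)) (- lucas (2 * m + 1) + 1))"
    using is_R_even_0_1[OF m] is_R_odd_0_1[of m] not_phi_block_1_even_0_1[OF m] is_R_1_odd_0_1[of m]
    by blast
qed

end
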